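(* Let $B_0,R_0,N_0,A_0>0$, let $\beta_R,\beta_N,\beta_A,\gamma_A>0$, and let $0\le \alpha_d^N\le\alpha_c^N$ with $\alpha_c^N>0$. For a constant fire allocation $\Pi=(\pi_1,\pi_2,\pi_3)\in\mathcal P$, where $$\mathcal P=\{(\pi_1,\pi_2,\pi_3):\ \pi_1+\pi_2+\pi_3=1,\ \pi_i\in[0,1],\ \pi_i \text{ constant},\ i=1,2,3\},$$ let $(B_\Pi,R_\Pi,N_\Pi,A_\Pi)$ be the solution of $$\begin{aligned} \frac{dB}{dt}&=-\Big[\alpha_d^N+(\alpha_c^N-\alpha_d^N)\frac{N}{N_0}\Big]R-\gamma_A A,\\ \frac{dR}{dt}&=-\pi_1\beta_R B,\qquad \frac{dN}{dt}=-\pi_2\beta_N B,\qquad \frac{dA}{dt}=-\pi_3\beta_A B, \end{aligned}$$ with $B(0)=B_0$, $R(0)=R_0$, $N(0)=N_0$, $A(0)=A_0$. Define the threatening rates $$b_1=\alpha_c^N\beta_R,\qquad b_2=\frac{\beta_N(\alpha_c^N-\alpha_d^N)R_0}{N_0},\qquad b_3=\gamma_A\beta_A.$$ Then among all the fire allocations in $\mathcal P$ for the first stage, the optimal one for $B$ is $$\Pi^*=\begin{cases}(1,0,0) & \text{if } b_1\ge b_2 \text{ and } b_1\ge b_3,\\ (0,1,0) & \text{if } b_2\ge b_1\ge b_3 \text{ or } b_2\ge b_3\ge b_1,\\ (0,0,1) & \text{if } b_3\ge b_1\ge b_2 \text{ or } b_3\ge b_2\ge b_1.\end{cases}$$ That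 is, in each of the three cases (when ties make several cases apply, for each applicable choice of $\Pi^*$), for every $\Pi\in\mathcal P$ and every time $t\ge 0$ belonging to the first stage under both $\Pi^*$ and $\Pi$, one has $B_{\Pi^*}(t)\ge B_\Pi(t)$.
   Context: The model describes a battle of a Blue force $B$ against a Red party consisting of an independent force $A$ and a force $R$ supported by a supply unit $N$; $B(t),R(t),N(t),A(t)$ are the numbers of troops at time $t$. The constants $\beta_R,\beta_N,\beta_A$ are the attrition rates of $B$ against $R,N,A$; $\gamma_A$ is the attrition rate of $A$ against $B$; $\alpha_c^N$ and $\alpha_d^N$ are the fully-connected and disconnected attrition rates of $R$ against $B$. The components $\pi_1,\pi_2,\pi_3$ are the fractions of the firepower of $B$ directed at $R,N,A$ respectively, and are kept constant in time. First stage: for a given $\Pi\in\mathcal P$, the first stage is the time interval $[0,T_\Pi]$, where $T_\Pi\in(0,\infty]$ is the first instant at which one of $B_\Pi,R_\Pi,N_\Pi,A_\Pi$ reaches zero (and the interval is $[0,\infty)$ if $T_\Pi=\infty$). Thus on the first stage all four quantities are nonnegative. Optimal: an allocation in $\mathcal P$ is optimal for $B$ if the remaining number of troops of $B$ is maximal, at any instant of the first stage, among all allocations in $\mathcal P$. *)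

theory Defs
  imports Complex_Main "HOL-Library.Extended_Real"
begin

text \<open>
  Initial strengths of the Blue force, of the supported force \<open>R\<close>, of its supply unit \<open>N\<close> and of the
  independent force \<open>A\<close>; attrition rates of Blue against \<open>R\<close>, \<open>N\<close>, \<open>A\<close>; attrition rate of \<open>A\<close> against
  Blue; fully connected and disconnected attrition rates of \<open>R\<close> against Blue.
\<close>

record battle =
  B\<^sub>0 :: real
  R\<^sub>0 :: real
  N\<^sub>0 :: real
  A\<^sub>0 :: real
  \<beta>\<^sub>R :: real
  \<beta>\<^sub>N :: real
  \<beta>\<^sub>A :: real
  \<gamma>\<^sub>A :: real
  \<alpha>\<^sub>c :: real
  \<alpha>\<^sub>d :: real

text \<open>
  An allocation lists the constant fractions of Blue's fire directed at \<open>R\<close>, \<open>N\<close>, \<open>A\<close>, in this order.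
\<close>

definition allocations :: "(real \<times> real \<times> real) set" where
  "allocations = {(p1, p2, p3). p1 + p2 + p3 = 1 \<and>
     p1 \<in> {0..1} \<and> p2 \<in> {0..1} \<and> p3 \<in> {0..1}}"

text \<open>
  Derivatives are taken within \<open>J\<close>, hence are one-sided at endpoints of \<open>J\<close>.
\<close>

definition solution_on ::
  "battle \<Rightarrow> real \<times> real \<times> real \<Rightarrow> real set \<Rightarrow>
   (real \<Rightarrow> real) \<Rightarrow> (real \<Rightarrow> real) \<Rightarrow> (real \<Rightarrow> real) \<Rightarrow> (real \<Rightarrow> real) \<Rightarrow> bool" where
  "solution_on M p J B R N A \<longleftrightarrow> (case p of (p1, p2, p3) \<Rightarrow>
     B 0 = B\<^sub>0 M \<and> R 0 = R\<^sub>0 M \<and> N 0 = N\<^sub>0 M \<and> A 0 = A\<^sub>0 M \<and>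
     (\<forall>t\<in>J.
        (B has_real_derivative
           (- (\<alpha>\<^sub>d M + (\<alpha>\<^sub>c M - \<alpha>\<^sub>d M) * (N t / N\<^sub>0 M)) * R t - \<gamma>\<^sub>A M * A t)) (at t within J) \<and>
        (R has_real_derivative (- p1 * \<beta>\<^sub>R M * B t)) (at t within J) \<and>
        (N has_real_derivative (- p2 * \<beta>\<^sub>N M * B t)) (at t within J) \<and>
        (A has_real_derivative (- p3 * \<beta>\<^sub>A M * B t)) (at t within J)))"

text \<open>\<open>T = \<infinity>\<close> encodes that none of the four quantities ever reaches zero.\<close>

definition first_zero_time ::
  "ereal \<Rightarrow> (real \<Rightarrow> real) \<Rightarrow> (real \<Rightarrow> real) \<Rightarrow> (real \<Rightarrow> real) \<Rightarrow> (real \<Rightarrow> real) \<Rightarrow> bool" where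
  "first_zero_time T B R N A \<longleftrightarrow> 0 < T \<and>
     (\<forall>t\<ge>0. ereal t < T \<longrightarrow> B t \<noteq> 0 \<and> R t \<noteq> 0 \<and> N t \<noteq> 0 \<and> A t \<noteq> 0) \<and>
     (\<forall>t. T = ereal t \<longrightarrow> B t = 0 \<or> R t = 0 \<or> N t = 0 \<or> A t = 0)"

definition stage :: "ereal \<Rightarrow> real set" where
  "stage T = {t. 0 \<le> t \<and> ereal t \<le> T}"

text \<open>
  The solution is only required on the first stage itself: beyond it the system may blow up in
  finite time, so a solution on all of \<open>[0, \<infinity>)\<close> need not exist.
\<close>

definition first_stage_solution ::
  "battle \<Rightarrow> real \<times> real \<times> real \<Rightarrow> ereal \<Rightarrow>
   (real \<Rightarrow> real) \<Rightarrow> (real \<Rightarrow> real) \<Rightarrow> (real \<Rightarrow> real) \<Rightarrow> (real \<Rightarrow> real) \<Rightarrow> bool" where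
  "first_stage_solution M p T B R N A \<longleftrightarrow>
     first_zero_time T B R N A \<and> solution_on M p (stage T) B R N A"

text \<open>
  The remaining troops under two allocations are compared at the times belonging to the first
  stages of both.
\<close>

definition optimal_for_B :: "battle \<Rightarrow> real \<times> real \<times> real \<Rightarrow> bool" where
  "optimal_for_B M q \<longleftrightarrow> q \<in> allocations \<and>
     (\<forall>p\<in>allocations. \<forall>T' B' R' N' A' T B R N A.
        first_stage_solution M q T' B' R' N' A' \<longrightarrow>
        first_stage_solution M p T B R N A \<longrightarrow>
        (\<forall>t \<in> stage T' \<inter> stage T. B t \<le> B' t))"

end

theory Submission
  imports Defs
begin

text \<open>
  With \<open>x(t) = \<integral>\<^sub>0\<^sup>t B\<close> the three Red forces are affine in \<open>x\<close>, so the system collapses to the scalar equation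
  \<open>x'' = - C + (p\<^sub>1 b\<^sub>1 + p\<^sub>2 b\<^sub>2 + p\<^sub>3 b\<^sub>3) x - K p\<^sub>1 p\<^sub>2 x\<^sup>2\<close> with \<open>K \<ge> 0\<close> and \<open>C\<close> independent of the
  allocation. The candidate optimum turns this into \<open>x'' = - C + m x\<close> with \<open>m = max b\<^sub>i > 0\<close>, while any
  other allocation gives \<open>x'' \<le> - C + m x\<close> since \<open>x \<ge> 0\<close>. The difference \<open>y\<close> satisfies
  \<open>y'' \<ge> m y\<close> and \<open>y(0) = y'(0) = 0\<close>, and factoring \<open>d\<^sup>2/dt\<^sup>2 - m\<close> into first-order operators yields \<open>y' \<ge> 0\<close>.
\<close>

section \<open>Differential inequalities on compact intervals\<close>

lemma has_real_derivative_nonneg_imp_le: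
  fixes f f' :: "real \<Rightarrow> real"
  assumes "a \<le> b"
    and deriv: "\<And>s. s \<in> {a..b} \<Longrightarrow> (f has_real_derivative f' s) (at s within {a..b})"
    and nonneg: "\<And>s. a < s \<Longrightarrow> s < b \<Longrightarrow> 0 \<le> f' s"
  shows "f a \<le> f b"
proof (rule DERIV_nonneg_imp_increasing_open[OF \<open>a \<le> b\<close>])
  fix s assume s: "a < s" "s < b"
  then have "(f has_real_derivative f' s) (at s)"
    using deriv[of s] by (simp add: at_within_Icc_at)
  then show "\<exists>y. DERIV f s :> y \<and> 0 \<le> y"
    using nonneg[OF s] by blast
next
  show "continuous_on {a..b} f"
    using deriv DERIV_continuous_on by blast
qed

lemma has_real_derivative_zero_imp_eq:
  fixes f :: "real \<Rightarrow> real"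
  assumes "a \<le> b"
    and "\<And>s. s \<in> {a..b} \<Longrightarrow> (f has_real_derivative 0) (at s within {a..b})"
  shows "f b = f a"
proof (rule antisym)
  show "f a \<le> f b"
    using assms by (rule has_real_derivative_nonneg_imp_le) auto
  have "- f a \<le> - f b"
    using assms(1)
  proof (rule has_real_derivative_nonneg_imp_le)
    show "((\<lambda>s. - f s) has_real_derivative 0) (at s within {a..b})" if "s \<in> {a..b}" for s
      using DERIV_minus[OF assms(2)[OF that]] by simp
  qed simp
  then show "f b \<le> f a" by simp
qed

text \<open>The integrating factor \<open>exp (- w * s)\<close> turns the inequality into
  monotonicity of \<open>exp (- w * s) * u s\<close>; no sign of \<open>w\<close> is assumed, so
  both square roots of a number can be used below.\<close>

lemma first_order_differential_inequality:
  fixes u u' :: "real \<Rightarrow> real"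
  assumes "a \<le> b"
    and deriv: "\<And>s. s \<in> {a..b} \<Longrightarrow> (u has_real_derivative u' s) (at s within {a..b})"
    and ineq: "\<And>s. s \<in> {a..b} \<Longrightarrow> w * u s \<le> u' s"
    and "0 \<le> u a"
  shows "0 \<le> u b"
proof -
  have "exp (- w * a) * u a \<le> exp (- w * b) * u b"
  proof (rule has_real_derivative_nonneg_imp_le[OF \<open>a \<le> b\<close>])
    show "((\<lambda>s. exp (- w * s) * u s) has_real_derivative exp (- w * s) * (u' s - w * u s))
        (at s within {a..b})" if "s \<in> {a..b}" for s
      by (rule derivative_eq_intros deriv that refl | simp add: algebra_simps)+
    show "0 \<le> exp (- w * s) * (u' s - w * u s)" if "a < s" "s < b" for s
      using ineq[of s] that by simp
  qed
  moreover have "0 \<le> exp (- w * a) * u a"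
    using \<open>0 \<le> u a\<close> by simp
  ultimately have "0 \<le> exp (- w * b) * u b"
    by linarith
  then show ?thesis
    by (simp add: zero_le_mult_iff)
qed

text \<open>For \<open>w * w = m\<close> the function \<open>z = y' + w * y\<close> satisfies
  \<open>z' = y'' + w * y' \<ge> w * z\<close>, so the first-order inequality applies to it.\<close>

lemma second_order_differential_inequality:
  fixes y y' y'' :: "real \<Rightarrow> real"
  assumes "a \<le> b" "0 \<le> m"
    and dy: "\<And>s. s \<in> {a..b} \<Longrightarrow> (y has_real_derivative y' s) (at s within {a..b})"
    and dy': "\<And>s. s \<in> {a..b} \<Longrightarrow> (y' has_real_derivative y'' s) (at s within {a..b})"
    and ineq: "\<And>s. s \<in> {a..b} \<Longrightarrow> m * y s \<le> y'' s"
    and init: "y a = 0" "y' a = 0"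
  shows "0 \<le> y' b"
proof -
  have factor: "0 \<le> y' b + w * y b" if w: "w * w = m" for w
  proof (rule first_order_differential_inequality[OF \<open>a \<le> b\<close>])
    show "((\<lambda>s. y' s + w * y s) has_real_derivative y'' s + w * y' s) (at s within {a..b})"
      if "s \<in> {a..b}" for s
      by (rule derivative_eq_intros dy dy' that refl | simp)+
    show "w * (y' s + w * y s) \<le> y'' s + w * y' s" if "s \<in> {a..b}" for s
      using ineq[OF that] by (simp add: w[symmetric] algebra_simps)
    show "0 \<le> y' a + w * y a"
      using init by simp
  qed
  \<comment> \<open>Adding the two inequalities cancels \<open>y b\<close> and leaves
    \<open>2 * y' b \<ge> 0\<close>.\<close>
  from factor[of "sqrt m"] factor[of "- sqrt m"] \<open>0 \<le> m\<close> show ?thesis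
    by simp
qed

lemma continuous_nonzero_imp_pos:
  fixes f :: "real \<Rightarrow> real"
  assumes "continuous_on {a..b} f" "a \<le> b" "0 < f a" "\<And>s. s \<in> {a..b} \<Longrightarrow> f s \<noteq> 0"
  shows "0 < f b"
proof (rule ccontr)
  assume "\<not> 0 < f b"
  then obtain s where "a \<le> s" "s \<le> b" "f s = 0"
    using IVT2'[of f b 0 a] assms by force
  then show False
    using assms(4) by simp
qed

text \<open>Along a solution this is \<open>\<integral>\<^sub>0\<^sup>t B\<close>, because the fractions of an allocation sum to one.\<close>

definition expended_fire ::
  "battle \<Rightarrow> (real \<Rightarrow> real) \<Rightarrow> (real \<Rightarrow> real) \<Rightarrow> (real \<Rightarrow> real) \<Rightarrow> real \<Rightarrow> real" where
  "expended_fire M R N A t =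
     (R\<^sub>0 M - R t) / \<beta>\<^sub>R M + (N\<^sub>0 M - N t) / \<beta>\<^sub>N M + (A\<^sub>0 M - A t) / \<beta>\<^sub>A M"

section \<open>Restriction to subintervals and positivity on the first stage\<close>

lemma stage_downward_closed:
  assumes "t \<in> stage T" "0 \<le> s" "s \<le> t"
  shows "s \<in> stage T"
proof -
  have "ereal s \<le> ereal t" using assms by simp
  also have "\<dots> \<le> T" using assms by (simp add: stage_def)
  finally show ?thesis using assms by (simp add: stage_def)
qed

lemma solution_on_subset:
  assumes "solution_on M p J B R N A" "I \<subseteq> J"
  shows "solution_on M p I B R N A"
  using assms unfolding solution_on_def
  by (auto split: prod.splits intro!: DERIV_subset[OF _ assms(2)])

text \<open>\<open>B\<close> starts positive, is continuous and has no zero before \<open>T\<close>.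
  The inequality \<open>s < t\<close> is strict because \<open>B\<close> may vanish at the final
  instant \<open>T\<close> itself.\<close>

lemma first_stage_solution_pos:
  assumes sol: "first_stage_solution M p T B R N A"
    and "0 < B\<^sub>0 M" "t \<in> stage T" "0 \<le> s" "s < t"
  shows "0 < B s"
proof -
  have "{0..s} \<subseteq> stage T"
    using assms stage_downward_closed by fastforce
  with sol have "solution_on M p {0..s} B R N A"
    unfolding first_stage_solution_def using solution_on_subset by blast
  then have B0: "B 0 = B\<^sub>0 M" and cont: "continuous_on {0..s} B"
    unfolding solution_on_def by (auto split: prod.splits intro: DERIV_continuous_on)
  have "ereal r < T" if "r \<in> {0..s}" for r
  proof -
    have "ereal r < ereal t" using that assms by simp
    also have "\<dots> \<le> T" using assms by (simp add: stage_def)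
    finally show ?thesis .
  qed
  then have "B r \<noteq> 0" if "r \<in> {0..s}" for r
    using that sol unfolding first_stage_solution_def first_zero_time_def by auto
  then show ?thesis
    using continuous_nonzero_imp_pos[OF cont] assms B0 by simp
qed

section \<open>Scalar equation and comparison of allocations\<close>

locale positive_battle =
  fixes M :: battle
  assumes pos: "0 < B\<^sub>0 M" "0 < R\<^sub>0 M" "0 < N\<^sub>0 M" "0 < \<beta>\<^sub>R M" "0 < \<beta>\<^sub>N M" "0 < \<beta>\<^sub>A M"
    and connected: "\<alpha>\<^sub>d M \<le> \<alpha>\<^sub>c M" "0 < \<alpha>\<^sub>c M"
begin

text \<open>The coefficient of \<open>x\<close> in the scalar equation: the mean of the three
  threatening rates weighted by the allocation.\<close>

definition threat :: "real \<times> real \<times> real \<Rightarrow> real" where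
  "threat p = (case p of (p1, p2, p3) \<Rightarrow>
     p1 * (\<alpha>\<^sub>c M * \<beta>\<^sub>R M) + p2 * (\<beta>\<^sub>N M * (\<alpha>\<^sub>c M - \<alpha>\<^sub>d M) * R\<^sub>0 M / N\<^sub>0 M) + p3 * (\<gamma>\<^sub>A M * \<beta>\<^sub>A M))"

text \<open>The coefficient of \<open>- x\<^sup>2\<close>; it comes from the product of
  \<open>N\<close> and \<open>R\<close> in the supply term, both being affine in
  \<open>x\<close>.\<close>

definition quadratic_threat :: "real \<times> real \<times> real \<Rightarrow> real" where
  "quadratic_threat p = (case p of (p1, p2, p3) \<Rightarrow>
     p1 * p2 * ((\<alpha>\<^sub>c M - \<alpha>\<^sub>d M) * \<beta>\<^sub>R M * \<beta>\<^sub>N M / N\<^sub>0 M))"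

lemma quadratic_threat_nonneg:
  "p \<in> allocations \<Longrightarrow> 0 \<le> quadratic_threat p"
  using pos connected by (auto simp: allocations_def quadratic_threat_def)

lemma scalar_reduction:
  fixes x R N A :: "real \<Rightarrow> real"
  defines "x \<equiv> expended_fire M R N A"
  assumes p: "p \<in> allocations" and sol: "solution_on M p {0..t} B R N A" and s: "s \<in> {0..t}"
  shows "x 0 = 0"
    and "(x has_real_derivative B s) (at s within {0..t})"
    and "(B has_real_derivative
      threat p * x s - quadratic_threat p * (x s)\<^sup>2 - (\<alpha>\<^sub>c M * R\<^sub>0 M + \<gamma>\<^sub>A M * A\<^sub>0 M))
      (at s within {0..t})"
proof -
  obtain p1 p2 p3 where p_eq: "p = (p1, p2, p3)" by (cases p)
  with p have sum: "p1 + p2 + p3 = 1" by (simp add: allocations_def)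
  have init: "R 0 = R\<^sub>0 M" "N 0 = N\<^sub>0 M" "A 0 = A\<^sub>0 M"
    and dB: "\<And>r. r \<in> {0..t} \<Longrightarrow> (B has_real_derivative
           (- (\<alpha>\<^sub>d M + (\<alpha>\<^sub>c M - \<alpha>\<^sub>d M) * (N r / N\<^sub>0 M)) * R r - \<gamma>\<^sub>A M * A r)) (at r within {0..t})"
    and dR: "\<And>r. r \<in> {0..t} \<Longrightarrow> (R has_real_derivative (- p1 * \<beta>\<^sub>R M * B r)) (at r within {0..t})"
    and dN: "\<And>r. r \<in> {0..t} \<Longrightarrow> (N has_real_derivative (- p2 * \<beta>\<^sub>N M * B r)) (at r within {0..t})"
    and dA: "\<And>r. r \<in> {0..t} \<Longrightarrow> (A has_real_derivative (- p3 * \<beta>\<^sub>A M * B r)) (at r within {0..t})"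
    using sol unfolding solution_on_def p_eq by auto
  show x0: "x 0 = 0"
    by (simp add: x_def expended_fire_def init)
  have dx: "(x has_real_derivative B r) (at r within {0..t})" if "r \<in> {0..t}" for r
  proof -
    have "(x has_real_derivative (p1 + p2 + p3) * B r) (at r within {0..t})"
      unfolding x_def expended_fire_def[abs_def]
      using pos by (auto intro!: derivative_eq_intros dR dN dA that simp: field_simps)
    then show ?thesis by (simp add: sum)
  qed
  then show "(x has_real_derivative B s) (at s within {0..t})"
    using s .
  \<comment> \<open>Since \<open>x\<close> has derivative \<open>B\<close>, the combination
    \<open>F + c * x\<close> is a conserved quantity; it is used for each of the three Red
    forces.\<close>
  have affine: "F s = F 0 - c * x s"
    if dF: "\<And>r. r \<in> {0..t} \<Longrightarrow> (F has_real_derivative (- c * B r)) (at r within {0..t})" for F c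
  proof -
    have "F s + c * x s = F 0 + c * x 0"
    proof (rule has_real_derivative_zero_imp_eq[where f = "\<lambda>r. F r + c * x r"])
      fix r assume "r \<in> {0..s}"
      then have r: "r \<in> {0..t}" using s by simp
      have "((\<lambda>r. F r + c * x r) has_real_derivative 0) (at r within {0..t})"
        by (rule derivative_eq_intros dF dx r refl | simp)+
      then show "((\<lambda>r. F r + c * x r) has_real_derivative 0) (at r within {0..s})"
        by (rule DERIV_subset) (use s in auto)
    qed (use s in simp)
    then show ?thesis using x0 by simp
  qed
  have R: "R s = R\<^sub>0 M - p1 * \<beta>\<^sub>R M * x s"
    using affine[of R "p1 * \<beta>\<^sub>R M"] dR init by simp
  have N: "N s = N\<^sub>0 M - p2 * \<beta>\<^sub>N M * x s"
    using affine[of N "p2 * \<beta>\<^sub>N M"] dN init by simp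
  have A: "A s = A\<^sub>0 M - p3 * \<beta>\<^sub>A M * x s"
    using affine[of A "p3 * \<beta>\<^sub>A M"] dA init by simp
  \<comment> \<open>At \<open>x = 0\<close> the supply bracket equals
    \<open>\<alpha>\<^sub>c M\<close>, hence the constant term; its decrease in \<open>x\<close>,
    multiplied by \<open>R\<^sub>0 M\<close>, yields the second threatening rate.\<close>
  have "- (\<alpha>\<^sub>d M + (\<alpha>\<^sub>c M - \<alpha>\<^sub>d M) * (N s / N\<^sub>0 M)) * R s - \<gamma>\<^sub>A M * A s =
      threat p * x s - quadratic_threat p * (x s)\<^sup>2 - (\<alpha>\<^sub>c M * R\<^sub>0 M + \<gamma>\<^sub>A M * A\<^sub>0 M)"
    unfolding R N A threat_def quadratic_threat_def p_eq
    using pos by (simp add: field_simps power2_eq_square)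
  then show "(B has_real_derivative
      threat p * x s - quadratic_threat p * (x s)\<^sup>2 - (\<alpha>\<^sub>c M * R\<^sub>0 M + \<gamma>\<^sub>A M * A\<^sub>0 M))
      (at s within {0..t})"
    using dB[OF s] by simp
qed

text \<open>With \<open>quadratic_threat q = 0\<close> the equation for \<open>q\<close> is linear,
  while a competitor has at most the same linear coefficient and a quadratic term that can only
  lower the derivative of \<open>B\<close>.\<close>

lemma optimal_for_B_if_threat_maximal:
  assumes q: "q \<in> allocations" and maximal: "\<And>p. p \<in> allocations \<Longrightarrow> threat p \<le> threat q"
    and quad: "quadratic_threat q = 0"
  shows "optimal_for_B M q"
  unfolding optimal_for_B_def
proof (intro conjI ballI allI impI)
  show "q \<in> allocations" by (rule q)
next
  fix p T' B' R' N' A' T B R N A t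
  assume p: "p \<in> allocations"
    and sol': "first_stage_solution M q T' B' R' N' A'"
    and sol: "first_stage_solution M p T B R N A"
    and t: "t \<in> stage T' \<inter> stage T"
  then have "0 \<le> t" by (simp add: stage_def)
  have on': "solution_on M q {0..t} B' R' N' A'" and on: "solution_on M p {0..t} B R N A"
    using sol sol' t unfolding first_stage_solution_def
    by (auto elim!: solution_on_subset intro: stage_downward_closed)
  define x where "x = expended_fire M R N A"
  define x' where "x' = expended_fire M R' N' A'"
  note red = scalar_reduction[OF p on, folded x_def]
  note red' = scalar_reduction[OF q on', folded x'_def]
  have x_nonneg: "0 \<le> x s" if s: "s \<in> {0..t}" for s
  proof -
    have "x 0 \<le> x s"
    proof (rule has_real_derivative_nonneg_imp_le[where f = x])
      show "(x has_real_derivative B r) (at r within {0..s})" if "r \<in> {0..s}" for r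
        using DERIV_subset[OF red(2)[of r], of "{0..s}"] s that by auto
      \<comment> \<open>The sign of \<open>B\<close> is needed only in the open interval, so a zero
        of \<open>B\<close> at the end of the stage does no harm.\<close>
      show "0 \<le> B r" if "0 < r" "r < s" for r
        using first_stage_solution_pos[OF sol, of t r] pos t s that by auto
    qed (use s in simp)
    then show ?thesis
      using red(1)[of 0] \<open>0 \<le> t\<close> by simp
  qed
  \<comment> \<open>Any allocation of positive threat bounds the maximum from below; this gives the
    sign of \<open>m\<close> required for taking \<open>sqrt m\<close>.\<close>
  have "0 < threat (1, 0, 0)"
    using pos connected by (simp add: threat_def)
  also have "\<dots> \<le> threat q"
    by (rule maximal) (simp add: allocations_def)
  finally have threat_pos: "0 < threat q" .
  define C where "C = \<alpha>\<^sub>c M * R\<^sub>0 M + \<gamma>\<^sub>A M * A\<^sub>0 M"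
  have "0 \<le> B' t - B t"
  proof (rule second_order_differential_inequality[where y = "\<lambda>s. x' s - x s"
        and y' = "\<lambda>s. B' s - B s" and m = "threat q"])
    show "((\<lambda>s. x' s - x s) has_real_derivative B' s - B s) (at s within {0..t})"
      if "s \<in> {0..t}" for s
      using DERIV_diff red'(2) red(2) that by blast
    show "((\<lambda>s. B' s - B s) has_real_derivative
        (threat q * x' s - quadratic_threat q * (x' s)\<^sup>2 - C) -
        (threat p * x s - quadratic_threat p * (x s)\<^sup>2 - C)) (at s within {0..t})"
      if "s \<in> {0..t}" for s
      unfolding C_def using DERIV_diff red'(3) red(3) that by blast
    show "threat q * (x' s - x s) \<le> (threat q * x' s - quadratic_threat q * (x' s)\<^sup>2 - C) -
        (threat p * x s - quadratic_threat p * (x s)\<^sup>2 - C)" if "s \<in> {0..t}" for s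
    proof -
      have "threat p * x s \<le> threat q * x s"
        using maximal[OF p] x_nonneg[OF that] by (rule mult_right_mono)
      moreover have "0 \<le> quadratic_threat p * (x s)\<^sup>2"
        using quadratic_threat_nonneg[OF p] by simp
      ultimately show ?thesis
        by (simp add: quad right_diff_distrib)
    qed
    show "x' 0 - x 0 = 0"
      using red(1)[of 0] red'(1)[of 0] \<open>0 \<le> t\<close> by simp
    show "B' 0 - B 0 = 0"
      using on on' unfolding solution_on_def by (auto split: prod.splits)
  qed (use \<open>0 \<le> t\<close> threat_pos in auto)
  then show "B t \<le> B' t" by simp
qed

text \<open>A convex combination of the three rates cannot exceed a common upper bound, so the
  maximum is attained at a vertex of the simplex.\<close>

lemma threat_le:
  assumes "p \<in> allocations" "\<alpha>\<^sub>c M * \<beta>\<^sub>R M \<le> m"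
    "\<beta>\<^sub>N M * (\<alpha>\<^sub>c M - \<alpha>\<^sub>d M) * R\<^sub>0 M / N\<^sub>0 M \<le> m" "\<gamma>\<^sub>A M * \<beta>\<^sub>A M \<le> m"
  shows "threat p \<le> m"
proof -
  obtain p1 p2 p3 where p: "p = (p1, p2, p3)" by (cases p)
  with assms(1) have nonneg: "0 \<le> p1" "0 \<le> p2" "0 \<le> p3" and sum: "p1 + p2 + p3 = 1"
    by (auto simp: allocations_def)
  have "threat p \<le> p1 * m + p2 * m + p3 * m"
    unfolding threat_def p prod.case using nonneg assms(2-4)
    by (intro add_mono mult_left_mono)
  also have "\<dots> = m"
    using sum by (simp flip: distrib_right)
  finally show ?thesis .
qed

end

theorem theorem1:
  fixes M :: battle and b1 b2 b3 :: real
  assumes "B\<^sub>0 M > 0" and "R\<^sub>0 M > 0" and "N\<^sub>0 M > 0" and "A\<^sub>0 M > 0"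
    and "\<beta>\<^sub>R M > 0" and "\<beta>\<^sub>N M > 0" and "\<beta>\<^sub>A M > 0" and "\<gamma>\<^sub>A M > 0"
    and "0 \<le> \<alpha>\<^sub>d M" and "\<alpha>\<^sub>d M \<le> \<alpha>\<^sub>c M" and "\<alpha>\<^sub>c M > 0"
    and "b1 = \<alpha>\<^sub>c M * \<beta>\<^sub>R M"
    and "b2 = \<beta>\<^sub>N M * (\<alpha>\<^sub>c M - \<alpha>\<^sub>d M) * R\<^sub>0 M / N\<^sub>0 M"
    and "b3 = \<gamma>\<^sub>A M * \<beta>\<^sub>A M"
  shows "(b1 \<ge> b2 \<and> b1 \<ge> b3 \<longrightarrow> optimal_for_B M (1, 0, 0)) \<and>
    (b2 \<ge> b1 \<and> b1 \<ge> b3 \<or> b2 \<ge> b3 \<and> b3 \<ge> b1 \<longrightarrow> optimal_for_B M (0, 1, 0)) \<and>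
    (b3 \<ge> b1 \<and> b1 \<ge> b2 \<or> b3 \<ge> b2 \<and> b2 \<ge> b1 \<longrightarrow> optimal_for_B M (0, 0, 1))"
proof -
  interpret positive_battle M
    using assms by unfold_locales auto
  \<comment> \<open>At every vertex \<open>p1 * p2 = 0\<close>, so the quadratic term vanishes. Only
    weak inequalities between the rates enter, which covers ties.\<close>
  have optimal: "optimal_for_B M q"
    if "q \<in> {(1, 0, 0), (0, 1, 0), (0, 0, 1)}" "b1 \<le> threat q" "b2 \<le> threat q" "b3 \<le> threat q" for q
  proof (rule optimal_for_B_if_threat_maximal)
    show "q \<in> allocations"
      using that(1) by (auto simp: allocations_def)
    show "quadratic_threat q = 0"
      using that(1) by (auto simp: quadratic_threat_def)
    show "threat p \<le> threat q" if "p \<in> allocations" for p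
      using that \<open>b1 \<le> threat q\<close> \<open>b2 \<le> threat q\<close> \<open>b3 \<le> threat q\<close> assms(12-14)
      by (intro threat_le) auto
  qed
  have "threat (1, 0, 0) = b1" "threat (0, 1, 0) = b2" "threat (0, 0, 1) = b3"
    using assms(12-14) by (simp_all add: threat_def)
  with optimal show ?thesis
    by (intro conjI impI) auto
qed

end
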